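(* Let $n\in\mathbb{N}$, let $s(n)=(n+1)(n+2)/2$, and let $p\in\mathbb{R}[x]_n$ be the constant polynomial $p(x)=s(n)$ for all $x\in\mathbb{R}$. Consider the optimization problem over vectors $\mathbf{c}=(c_{ij})_{(i,j)\in\mathbb{N}^2_n}\in\mathbb{R}^{s(n)}$ $$\mathbf{P}:\quad \sup_{\mathbf{c}>0}\Big\{\sum_{(i,j)\in\mathbb{N}^2_n}\log c_{ij}\ :\ p(x)=\sum_{(i,j)\in\mathbb{N}^2_n}c_{ij}\,x^i(1-x)^j\,,\ \forall x\in\mathbb{R}\Big\}.$$ Then the vector $\mathbf{c}^*=(c^*_{ij})_{(i,j)\in\mathbb{N}^2_n}$ defined by $$\frac{1}{c^*_{ij}}=\int_0^1x^i(1-x)^j\,dx\,,\quad\forall (i,j)\in\mathbb{N}^2_n,$$ is the unique optimal solution of $\mathbf{P}$, and $$1=\frac{1}{s(n)}\sum_{(i,j)\in\mathbb{N}^2_n}\frac{x^i(1-x)^j}{\int_0^1 t^i(1-t)^j\,dt}=\frac{1}{s(n)}\sum_{(i,j)\in\mathbb{N}^2_n}\frac{B_{i+j,i}(x)}{\int_0^1B_{i+j,i}(t)\,dt}\,,\quad\forall x\in\mathbb{R}.$$ That is, the linear functional $\phi^*_p\in\mathscr{C}_n^*$ associated with $p$ through $1/c^*_{ij}=\phi^*_p(x^i(1-x)^j)$ for all $(i,j)\in\mathbb{N}^2_n$ (where $\mathbf{c}^*$ is the optimal solution of $\mathbf{P}$) is integration on $\mathbb{R}[x]_n$ with respect to Lebesgue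 measure on $[0,1]$, and the polynomials $\frac{k+1}{s(n)}B_{k,j}$, $0\le j\le k\le n$, form a partition of unity of $[0,1]$.
   Context: $\mathbb{N}=\{0,1,2,\ldots\}$ and $\mathbb{N}^2_n=\{(i,j)\in\mathbb{N}^2: i+j\le n\}$, which has $s(n)=\binom{n+2}{n}$ elements. $\mathbb{R}[x]_n$ is the space of real univariate polynomials of degree at most $n$, and $\mathbb{R}[x]_n^*$ its dual space of linear functionals. Inequalities $\mathbf{c}>0$ and $\mathbf{c}\ge0$ between vectors are entrywise. The Bernstein polynomials are $B_{k,j}(x)=\binom{k}{j}x^j(1-x)^{k-j}$ for $0\le j\le k$. The cone $\mathscr{C}_n^*$ is $\{\phi\in\mathbb{R}[x]_n^*:\ \phi(x^i(1-x)^j)\ge0\ \ \forall (i,j)\in\mathbb{N}^2_n\}$. A finite family of polynomials forms a partition of unity of $[0,1]$ if each is nonnegative on $[0,1]$ and they sum to $1$. *)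

theory Defs
  imports "HOL-Analysis.Analysis" "HOL-Computational_Algebra.Polynomial"
begin

definition N2 :: "nat \<Rightarrow> (nat \<times> nat) set" where
  "N2 n = {(i, j). i + j \<le> n}"

definition s :: "nat \<Rightarrow> real" where
  "s n = (real n + 1) * (real n + 2) / 2"

lemma s_eq_binomial: "s n = real ((n + 2) choose n)"
proof -
  have "(n + 2) choose n = (n + 2) choose 2"
    by (subst binomial_symmetric) auto
  also have "real \<dots> = s n"
    by (simp add: s_def choose_two real_of_nat_div algebra_simps)
  finally show ?thesis ..
qed

lemma card_N2: "real (card (N2 n)) = s n"
proof -
  have "N2 n = (SIGMA i:{..n}. {..n - i})"
    by (auto simp: N2_def)
  then have "card (N2 n) = (\<Sum>i\<le>n. Suc (n - i))"
    by simp
  also have "\<dots> = (\<Sum>i\<le>n. Suc i)"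
    by (rule sum.reindex_bij_witness[of _ "\<lambda>i. n - i" "\<lambda>i. n - i"]) auto
  also have "real \<dots> = s n"
    by (induction n) (auto simp: s_def field_simps)
  finally show ?thesis .
qed

definition polys :: "nat \<Rightarrow> real poly set" where
  "polys n = {q. degree q \<le> n}"

text \<open>
  Functionals are total functions in HOL; fixing the value \<open>undefined\<close> outside \<^term>\<open>polys n\<close>
  makes equality in \<open>dual n\<close> the equality of functionals on \<^term>\<open>polys n\<close>.
  Vectors indexed by \<^term>\<open>N2 n\<close> are treated in the same way below.
\<close>
definition dual :: "nat \<Rightarrow> (real poly \<Rightarrow> real) set" where
  "dual n = {\<phi> \<in> extensional (polys n).
     (\<forall>q\<in>polys n. \<forall>r\<in>polys n. \<phi> (q + r) = \<phi> q + \<phi> r) \<and>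
     (\<forall>a. \<forall>q\<in>polys n. \<phi> (smult a q) = a * \<phi> q)}"

definition basis_poly :: "nat \<Rightarrow> nat \<Rightarrow> real poly" where
  "basis_poly i j = [:0, 1:] ^ i * [:1, -1:] ^ j"

lemma poly_basis_poly: "poly (basis_poly i j) x = x ^ i * (1 - x) ^ j"
  by (simp add: basis_poly_def)

definition dual_cone :: "nat \<Rightarrow> (real poly \<Rightarrow> real) set" where
  "dual_cone n = {\<phi> \<in> dual n. \<forall>(i, j)\<in>N2 n. \<phi> (basis_poly i j) \<ge> 0}"

definition feasible :: "nat \<Rightarrow> real poly \<Rightarrow> (nat \<times> nat \<Rightarrow> real) set" where
  "feasible n p = {c \<in> N2 n \<rightarrow>\<^sub>E {0<..}.
     \<forall>x. poly p x = (\<Sum>(i, j)\<in>N2 n. c (i, j) * (x ^ i * (1 - x) ^ j))}"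

definition optimal_solution :: "nat \<Rightarrow> real poly \<Rightarrow> (nat \<times> nat \<Rightarrow> real) \<Rightarrow> bool" where
  "optimal_solution n p =
     is_arg_max (\<lambda>c. \<Sum>(i, j)\<in>N2 n. ln (c (i, j))) (\<lambda>c. c \<in> feasible n p)"

text \<open>The sum is required to be 1 as a polynomial, hence at every real point.\<close>
definition partition_of_unity :: "real set \<Rightarrow> 'i set \<Rightarrow> ('i \<Rightarrow> real \<Rightarrow> real) \<Rightarrow> bool" where
  "partition_of_unity S I f \<longleftrightarrow> finite I \<and>
     (\<forall>k\<in>I. real_polynomial_function (f k) \<and> (\<forall>x\<in>S. f k x \<ge> 0)) \<and>
     (\<forall>x. (\<Sum>k\<in>I. f k x) = 1)"

end

theory Submission
  imports Defs
begin

text \<open>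
  The vector \<open>c\<^sup>*\<close> is feasible because \<open>\<integral> B\<^sub>k\<^sub>,\<^sub>j = 1/(k+1)\<close>, while the Bernstein polynomials of each
  degree \<open>k\<close> sum to 1. Integrating the constraint shows \<open>\<Sum> c\<^sub>i\<^sub>j/c\<^sup>*\<^sub>i\<^sub>j = s n\<close>, the number of indices,
  for every feasible \<open>c\<close>, so summing \<open>ln t \<le> t - 1\<close> over \<open>t = c\<^sub>i\<^sub>j/c\<^sup>*\<^sub>i\<^sub>j\<close> gives optimality, and the
  equality case \<open>t = 1\<close> gives uniqueness.
\<close>

text \<open>This is the Beta integral at integer arguments. Induction on \<open>j\<close>, with
  \<open>i\<close> arbitrary, works because integration by parts trades a factor
  \<open>1 - x\<close> for a factor \<open>x\<close>.\<close>

lemma has_integral_monomial_complement: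
  "((\<lambda>x::real. x ^ i * (1 - x) ^ j) has_integral (fact i * fact j / fact (i + j + 1))) {0..1}"
proof -
  have cancel: "1 / (real i + 1) * ((real i + 1) * y) = y" for i and y :: real
    by (simp add: field_simps)
  show ?thesis
  proof (induction j arbitrary: i)
    case 0
    have "((\<lambda>x::real. (real i + 1) * x ^ i) has_integral (1 ^ Suc i - 0 ^ Suc i)) {0..1}"
      by (intro fundamental_theorem_of_calculus)
         (auto intro!: derivative_eq_intros simp flip: has_real_derivative_iff_has_vector_derivative
            simp: algebra_simps simp del: power_Suc)
    from has_integral_mult_right[OF this, of "1 / (real i + 1)"]
    have "((\<lambda>x::real. x ^ i) has_integral (1 / (real i + 1))) {0..1}"
      unfolding cancel by simp
    moreover have "fact i * fact 0 / fact (i + 0 + 1) = 1 / (real i + 1)"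
      by (simp add: add.commute)
    ultimately show ?case by (simp add: add.commute)
  next
    case (Suc j)
    \<comment> \<open>The integrand is the derivative of \<open>x ^ Suc i * (1 - x) ^ Suc j\<close>,
      which vanishes at both endpoints. Adding \<open>real j + 1\<close> times the induction
      hypothesis at \<open>Suc i\<close> removes the subtracted term.\<close>
    have "((\<lambda>x::real. (real i + 1) * (x ^ i * (1 - x) ^ Suc j) - (real j + 1) * (x ^ Suc i * (1 - x) ^ j))
        has_integral (1 ^ Suc i * (1 - 1) ^ Suc j - 0 ^ Suc i * (1 - 0) ^ Suc j)) {0..1}"
      by (intro fundamental_theorem_of_calculus)
         (auto intro!: derivative_eq_intros simp flip: has_real_derivative_iff_has_vector_derivative
            simp: algebra_simps simp del: power_Suc)
    from has_integral_add[OF this has_integral_mult_right[OF Suc.IH[of "Suc i"], of "real j + 1"]]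
    have "((\<lambda>x::real. (real i + 1) * (x ^ i * (1 - x) ^ Suc j))
        has_integral ((real j + 1) * (fact (Suc i) * fact j / fact (Suc i + j + 1)))) {0..1}"
      by simp
    from has_integral_mult_right[OF this, of "1 / (real i + 1)"]
    have "((\<lambda>x::real. x ^ i * (1 - x) ^ Suc j) has_integral
        (1 / (real i + 1) * ((real j + 1) * (fact (Suc i) * fact j / fact (Suc i + j + 1))))) {0..1}"
      unfolding cancel .
    also have "1 / (real i + 1) * ((real j + 1) * (fact (Suc i) * fact j / fact (Suc i + j + 1)))
        = fact i * fact (Suc j) / fact (i + Suc j + 1)"
      using cancel[of i "fact i * fact (Suc j) / fact (i + Suc j + 1)"]
      by (simp add: fact_Suc[of i] fact_Suc[of j] mult_ac add_ac del: fact_Suc)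
    finally show ?case .
  qed
qed

lemma degree_basis_poly: "degree (basis_poly i j) = i + j"
  by (simp add: basis_poly_def degree_mult_eq degree_power_eq)

lemma set_integrable_poly: "set_integrable lborel {0..1} (poly q)" for q :: "real poly"
  by (intro borel_integrable_atLeastAtMost') (auto intro!: continuous_intros)

lemma set_integrable_monomial_complement:
  "set_integrable lborel {0..1} (\<lambda>x::real. x ^ i * (1 - x) ^ j)"
  using set_integrable_poly[of "basis_poly i j"] by (simp add: poly_basis_poly[abs_def])

lemma set_lebesgue_integral_monomial_complement:
  "(LBINT x:{0..1::real}. x ^ i * (1 - x) ^ j) = 1 / ((real (i + j) + 1) * real ((i + j) choose i))"
proof -
  have "(LBINT x:{0..1::real}. x ^ i * (1 - x) ^ j) = fact i * fact j / fact (i + j + 1)"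
    using has_integral_monomial_complement set_integrable_monomial_complement
    by (simp add: set_borel_integral_eq_integral(2) integral_unique)
  also have "\<dots> = 1 / ((real (i + j) + 1) * real ((i + j) choose i))"
    by (simp add: binomial_fact field_simps)
  finally show ?thesis .
qed

text \<open>The binomial coefficient in \<open>Bernstein\<close> cancels the one in the Beta
  integral, so the value is the same for every \<open>j\<close>.\<close>

lemma set_lebesgue_integral_Bernstein:
  assumes "j \<le> k"
  shows "(LBINT x:{0..1}. Bernstein k j x) = 1 / (real k + 1)"
  using assms set_lebesgue_integral_monomial_complement[of j "k - j"]
  by (simp add: Bernstein_def mult.assoc)

text \<open>For each degree \<open>k\<close> the Bernstein polynomials sum to 1, so row
  \<open>k\<close> contributes \<open>k + 1\<close>, and these add up to a triangular
  number.\<close>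

lemma sum_Bernstein_triangle:
  "(\<Sum>(k, j)\<in>{(k, j). j \<le> k \<and> k \<le> n}. (real k + 1) * Bernstein k j x) = s n"
proof -
  have "{(k, j). j \<le> k \<and> k \<le> n} = (SIGMA k:{..n}. {..k})"
    by auto
  then have "(\<Sum>(k, j)\<in>{(k, j). j \<le> k \<and> k \<le> n}. (real k + 1) * Bernstein k j x)
      = (\<Sum>k\<le>n. \<Sum>j\<le>k. (real k + 1) * Bernstein k j x)"
    by (simp add: sum.Sigma)
  also have "\<dots> = (\<Sum>k\<le>n. real k + 1)"
    by (simp add: sum_Bernstein flip: sum_distrib_left)
  also have "\<dots> = s n"
    by (induction n) (auto simp: s_def field_simps)
  finally show ?thesis .
qed

lemma sum_Bernstein_N2: "(\<Sum>(i, j)\<in>N2 n. (real (i + j) + 1) * Bernstein (i + j) i x) = s n"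
proof -
  have "(\<Sum>(i, j)\<in>N2 n. (real (i + j) + 1) * Bernstein (i + j) i x)
      = (\<Sum>(k, j)\<in>{(k, j). j \<le> k \<and> k \<le> n}. (real k + 1) * Bernstein k j x)"
    \<comment> \<open>The pair \<open>(i, j)\<close> corresponds to degree \<open>i + j\<close> and
      Bernstein index \<open>i\<close>.\<close>
    by (rule sum.reindex_bij_witness[of _ "\<lambda>(k, j). (j, k - j)" "\<lambda>(i, j). (i + j, i)"])
       (auto simp: N2_def)
  then show ?thesis by (simp add: sum_Bernstein_triangle)
qed

lemma Bernstein_div_integral:
  "Bernstein (i + j) i x / (LBINT t:{0..1}. Bernstein (i + j) i t) = (real (i + j) + 1) * Bernstein (i + j) i x"
  by (simp add: set_lebesgue_integral_Bernstein)

text \<open>Dividing by the integral cancels any constant factor, so the monomial and its Bernstein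
  multiple have the same normalisation. The two sums in the theorem therefore agree term by
  term.\<close>

lemma monomial_complement_div_integral:
  "x ^ i * (1 - x) ^ j / (LBINT t:{0..1}. t ^ i * (1 - t) ^ j) = (real (i + j) + 1) * Bernstein (i + j) i x"
  by (simp add: set_lebesgue_integral_monomial_complement Bernstein_def)

lemma finite_N2: "finite (N2 n)"
  by (rule finite_subset[of _ "{..n} \<times> {..n}"]) (auto simp: N2_def)

text \<open>The gaps in \<open>ln t \<le> t - 1\<close> at \<open>t = c a / d a\<close> are
  nonnegative and, by \<open>ge\<close>, their sum is at most 0, so each one vanishes. Optimality
  and uniqueness both follow from this: a competitor at least as good as \<open>d\<close> is
  \<open>d\<close> itself.\<close>

lemma sum_ln_ge_imp_eq:
  fixes c d :: "'a \<Rightarrow> real"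
  assumes "finite A" and pos: "\<And>a. a \<in> A \<Longrightarrow> c a > 0" "\<And>a. a \<in> A \<Longrightarrow> d a > 0"
    and sum: "(\<Sum>a\<in>A. c a / d a) = card A"
    and ge: "(\<Sum>a\<in>A. ln (d a)) \<le> (\<Sum>a\<in>A. ln (c a))"
    and "a \<in> A"
  shows "c a = d a"
proof -
  let ?g = "\<lambda>a. c a / d a - 1 - ln (c a / d a)"
  have nonneg: "?g a \<ge> 0" if "a \<in> A" for a
    using ln_le_minus_one[of "c a / d a"] pos that by simp
  \<comment> \<open>By \<open>sum\<close>, the terms \<open>c a / d a - 1\<close> add up to 0, which
    leaves only the logarithms.\<close>
  have "sum ?g A = - ((\<Sum>a\<in>A. ln (c a)) - (\<Sum>a\<in>A. ln (d a)))"
    using sum pos ln_divide_pos by (simp add: sum_subtractf)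
  with ge have "sum ?g A = 0"
    using sum_nonneg[of A ?g] nonneg by force
  then have "?g a = 0"
    using sum_nonneg_eq_0_iff[of A ?g] \<open>finite A\<close> \<open>a \<in> A\<close> nonneg by blast
  then have "c a / d a = 1"
    using ln_eq_minus_one[of "c a / d a"] pos \<open>a \<in> A\<close> by simp
  then show ?thesis by simp
qed

lemma integral_functional_in_dual_cone:
  "(\<lambda>q\<in>polys n. LBINT x:{0..1}. poly q x) \<in> dual_cone n"
proof -
  have "q + r \<in> polys n" if "q \<in> polys n" "r \<in> polys n" for q r
    using that by (simp add: polys_def degree_add_le)
  moreover have "smult a q \<in> polys n" if "q \<in> polys n" for a q
    using that degree_smult_le[of a q] by (simp add: polys_def)
  moreover have "(LBINT x:{0..1}. poly (q + r) x) = (LBINT x:{0..1}. poly q x) + (LBINT x:{0..1}. poly r x)"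
    for q r :: "real poly"
    unfolding poly_add by (intro set_integral_add(2) set_integrable_poly)
  moreover have "(LBINT x:{0..1}. poly (smult a q) x) = a * (LBINT x:{0..1}. poly q x)"
    for a and q :: "real poly"
    unfolding poly_smult by (rule set_integral_mult_right)
  moreover have "(LBINT x:{0..1}. poly (basis_poly i j) x) \<ge> 0" for i j
    by (simp add: poly_basis_poly set_lebesgue_integral_monomial_complement)
  ultimately show ?thesis
    using degree_basis_poly
    by (auto simp: dual_cone_def dual_def N2_def polys_def
        simp del: poly_add poly_smult)
qed

text \<open>The polynomials \<open>basis_poly i 0\<close> are the powers of x, a basis of
  \<open>polys n\<close>; outside \<open>polys n\<close> both functionals are
  \<open>undefined\<close>.\<close>

lemma dual_eqI:
  assumes \<phi>: "\<phi> \<in> dual n" and \<psi>: "\<psi> \<in> dual n"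
    and eq: "\<And>i. i \<le> n \<Longrightarrow> \<phi> (basis_poly i 0) = \<psi> (basis_poly i 0)"
  shows "\<phi> = \<psi>"
proof (rule extensionalityI[of _ "polys n"])
  show "\<phi> \<in> extensional (polys n)" "\<psi> \<in> extensional (polys n)"
    using \<phi> \<psi> by (auto simp: dual_def)
  fix q assume "q \<in> polys n"
  \<comment> \<open>Additivity in \<open>dual n\<close> concerns only summands in
    \<open>polys n\<close>, so the induction also carries membership of the partial sums;
    \<open>m \<le> Suc n\<close> keeps their degrees at most \<open>n\<close>.\<close>
  have expand: "\<theta> (\<Sum>i<m. smult (coeff q i) (basis_poly i 0)) =
      (\<Sum>i<m. coeff q i * \<theta> (basis_poly i 0)) \<and>
      (\<Sum>i<m. smult (coeff q i) (basis_poly i 0)) \<in> polys n"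
    if \<theta>: "\<theta> \<in> dual n" and "m \<le> Suc n" for \<theta> m
    using that(2)
  proof (induction m)
    case 0
    \<comment> \<open>That \<open>\<theta> 0 = 0\<close> comes from homogeneity with scalar
      0.\<close>
    have "0 \<in> polys n" by (simp add: polys_def)
    then have "\<theta> (smult 0 0) = 0 * \<theta> 0" using \<theta> unfolding dual_def by blast
    then show ?case by (simp add: polys_def)
  next
    case (Suc m)
    have "basis_poly m 0 \<in> polys n" "smult (coeff q m) (basis_poly m 0) \<in> polys n"
      using Suc.prems by (simp_all add: polys_def degree_basis_poly)
    with Suc \<theta> show ?case
      by (auto simp: dual_def) (simp add: polys_def degree_add_le)
  qed
  have "q = (\<Sum>i\<le>n. monom (coeff q i) i)"
    using \<open>q \<in> polys n\<close> by (simp add: polys_def poly_as_sum_of_monoms')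
  also have "\<dots> = (\<Sum>i<Suc n. smult (coeff q i) (basis_poly i 0))"
    by (simp add: basis_poly_def monom_altdef lessThan_Suc_atMost del: sum.lessThan_Suc)
  finally have q: "q = (\<Sum>i<Suc n. smult (coeff q i) (basis_poly i 0))" .
  have "\<phi> q = (\<Sum>i<Suc n. coeff q i * \<phi> (basis_poly i 0))"
    using expand[OF \<phi>, of "Suc n"] q by simp
  also have "\<dots> = (\<Sum>i<Suc n. coeff q i * \<psi> (basis_poly i 0))"
    using eq by (intro sum.cong) auto
  also have "\<dots> = \<psi> q"
    using expand[OF \<psi>, of "Suc n"] q by simp
  finally show "\<phi> q = \<psi> q" .
qed

lemma set_integral_sum:
  fixes f :: "'i \<Rightarrow> 'a \<Rightarrow> 'b::{banach, second_countable_topology}"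
  assumes "\<And>i. i \<in> I \<Longrightarrow> set_integrable M A (f i)"
  shows "(LINT x:A|M. (\<Sum>i\<in>I. f i x)) = (\<Sum>i\<in>I. LINT x:A|M. f i x)"
  using assms unfolding set_lebesgue_integral_def set_integrable_def scaleR_sum_right
  by (rule Bochner_Integration.integral_sum)

text \<open>The interval has length 1, so integrating the constraint keeps its constant value. With
  \<open>card_N2\<close> this supplies the hypothesis \<open>sum\<close> of
  \<open>sum_ln_ge_imp_eq\<close>.\<close>

lemma sum_feasible_integral:
  assumes "c \<in> feasible n p" and "\<forall>x. poly p x = s n"
  shows "(\<Sum>(i, j)\<in>N2 n. c (i, j) * (LBINT x:{0..1}. x ^ i * (1 - x) ^ j)) = s n"
proof -
  have int: "set_integrable lborel {0..1} (\<lambda>x::real. a * (x ^ i * (1 - x) ^ j))" for a i j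
    by (simp add: set_integrable_monomial_complement)
  have "(\<Sum>(i, j)\<in>N2 n. c (i, j) * (LBINT x:{0..1}. x ^ i * (1 - x) ^ j))
      = (LBINT x:{0..1}. \<Sum>(i, j)\<in>N2 n. c (i, j) * (x ^ i * (1 - x) ^ j))"
    by (simp add: case_prod_unfold set_integral_sum int)
  also have "\<dots> = (LBINT x:{0..1::real}. s n)"
    using assms by (simp add: feasible_def)
  also have "\<dots> = s n"
    by (simp add: set_lebesgue_integral_def)
  finally show ?thesis .
qed

theorem theorem3p2:
  fixes n :: nat and p :: "real poly" and cstar :: "nat \<times> nat \<Rightarrow> real"
  assumes "p \<in> polys n" and "\<forall>x. poly p x = s n"
    and "cstar \<in> extensional (N2 n)"
    and "\<forall>(i, j)\<in>N2 n. 1 / cstar (i, j) = (LBINT x:{0..1}. x ^ i * (1 - x) ^ j)"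
  shows "(\<forall>c. optimal_solution n p c \<longleftrightarrow> c = cstar) \<and>
    (\<forall>x::real. 1 = 1 / s n * (\<Sum>(i, j)\<in>N2 n.
        x ^ i * (1 - x) ^ j / (LBINT t:{0..1}. t ^ i * (1 - t) ^ j))) \<and>
    (\<forall>x. 1 = 1 / s n * (\<Sum>(i, j)\<in>N2 n.
        Bernstein (i + j) i x / (LBINT t:{0..1}. Bernstein (i + j) i t))) \<and>
    (\<forall>\<phi>. (\<phi> \<in> dual_cone n \<and> (\<forall>(i, j)\<in>N2 n. 1 / cstar (i, j) = \<phi> (basis_poly i j)))
        \<longleftrightarrow> \<phi> = (\<lambda>q\<in>polys n. LBINT x:{0..1}. poly q x)) \<and>
    partition_of_unity {0..1} {(k, j). j \<le> k \<and> k \<le> n}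
      (\<lambda>(k, j) x. (real k + 1) / s n * Bernstein k j x)"
proof -
  let ?I = "\<lambda>i j. LBINT x:{0..1::real}. x ^ i * (1 - x) ^ j"
  have s_pos: "s n > 0"
    by (simp add: s_def)
  have I_pos: "?I i j > 0" for i j
    by (simp add: set_lebesgue_integral_monomial_complement)
  have cstar_inverse: "1 / cstar (i, j) = ?I i j" if "(i, j) \<in> N2 n" for i j
    using assms(4) that by auto
  \<comment> \<open>Inverting twice returns \<open>cstar (i, j)\<close> even if it were 0, since
    division by 0 gives 0; its positivity then follows from \<open>I_pos\<close>.\<close>
  have cstar_eq: "cstar (i, j) = 1 / ?I i j" if "(i, j) \<in> N2 n" for i j
    using cstar_inverse[OF that] by (metis div_by_1 divide_divide_eq_right mult_1)
  have sum_monomials: "(\<Sum>(i, j)\<in>N2 n. x ^ i * (1 - x) ^ j / ?I i j) = s n" for x :: real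
    unfolding monomial_complement_div_integral by (rule sum_Bernstein_N2)
  have "(\<Sum>(i, j)\<in>N2 n. cstar (i, j) * (x ^ i * (1 - x) ^ j)) = s n" for x
    unfolding sum_monomials[of x, symmetric]
    by (intro sum.cong) (auto simp: cstar_eq)
  then have cstar_feasible: "cstar \<in> feasible n p"
    using assms(2,3) I_pos by (auto simp: feasible_def PiE_iff cstar_eq)
  have eq_cstar: "c = cstar" if c: "c \<in> feasible n p"
    and ge: "(\<Sum>(i, j)\<in>N2 n. ln (cstar (i, j))) \<le> (\<Sum>(i, j)\<in>N2 n. ln (c (i, j)))" for c
  proof (rule extensionalityI[of _ "N2 n"])
    show "c \<in> extensional (N2 n)" using c by (auto simp: feasible_def PiE_iff)
    show "cstar \<in> extensional (N2 n)" by fact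
    fix a assume a: "a \<in> N2 n"
    have "(\<Sum>a\<in>N2 n. c a / cstar a) = (\<Sum>(i, j)\<in>N2 n. c (i, j) * ?I i j)"
      by (intro sum.cong) (auto simp: cstar_eq)
    also have "\<dots> = card (N2 n)"
      using sum_feasible_integral[OF c assms(2)] by (simp add: card_N2)
    finally show "c a = cstar a"
      using c cstar_feasible ge a
      by (intro sum_ln_ge_imp_eq[of "N2 n" c cstar])
         (auto simp: finite_N2 feasible_def PiE_iff case_prod_unfold)
  qed
  \<comment> \<open>A feasible vector strictly better than \<open>cstar\<close> would equal it by
    \<open>eq_cstar\<close>, a contradiction. An optimal vector is no worse than the feasible
    \<open>cstar\<close>, hence equals it.\<close>
  have optimal: "optimal_solution n p c \<longleftrightarrow> c = cstar" for c
    using cstar_feasible eq_cstar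
    unfolding optimal_solution_def is_arg_max_def by (metis less_le not_less)
  have functional: "(\<phi> \<in> dual_cone n \<and> (\<forall>(i, j)\<in>N2 n. 1 / cstar (i, j) = \<phi> (basis_poly i j)))
      \<longleftrightarrow> \<phi> = (\<lambda>q\<in>polys n. LBINT x:{0..1}. poly q x)" (is "?L \<phi> \<longleftrightarrow> \<phi> = ?\<psi>") for \<phi>
  proof
    have \<psi>: "?\<psi> (basis_poly i j) = ?I i j" if "(i, j) \<in> N2 n" for i j
      using that by (simp add: polys_def N2_def degree_basis_poly poly_basis_poly[abs_def])
    then have "1 / cstar (i, j) = ?\<psi> (basis_poly i j)" if "(i, j) \<in> N2 n" for i j
      using that by (simp only: cstar_inverse)
    then show "?L \<phi>" if "\<phi> = ?\<psi>"
      unfolding that using integral_functional_in_dual_cone[of n] by blast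
    \<comment> \<open>The prescribed values at the pairs \<open>(i, 0)\<close> with
      \<open>i \<le> n\<close> are the values on the powers of x, and these determine the
      functional.\<close>
    show "\<phi> = ?\<psi>" if "?L \<phi>"
    proof (rule dual_eqI)
      show "\<phi> \<in> dual n"
        using that by (simp add: dual_cone_def)
      show "?\<psi> \<in> dual n"
        using integral_functional_in_dual_cone[of n] unfolding dual_cone_def by blast
      show "\<phi> (basis_poly i 0) = ?\<psi> (basis_poly i 0)" if "i \<le> n" for i
      proof -
        have "(i, 0) \<in> N2 n" using that by (simp add: N2_def)
        then show ?thesis using \<open>?L \<phi>\<close> \<psi>[of i 0] cstar_inverse[of i 0] by fastforce
      qed
    qed
  qed
  have "finite {(k, j). j \<le> k \<and> k \<le> n}"
    by (rule finite_subset[of _ "{..n} \<times> {..n}"]) auto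
  moreover have "real_polynomial_function (\<lambda>x. (real k + 1) / s n * Bernstein k j x)" for k j
    unfolding Bernstein_def
    by (intro real_polynomial_function.intros real_polynomial_function_power
        real_polynomial_function_diff bounded_linear_ident)
  \<comment> \<open>The identity holds at every real \<open>x\<close>, as
    \<open>partition_of_unity\<close> demands; only nonnegativity is restricted to the
    interval.\<close>
  moreover have "(\<Sum>(k, j)\<in>{(k, j). j \<le> k \<and> k \<le> n}. (real k + 1) / s n * Bernstein k j x) = 1" for x
    using sum_Bernstein_triangle[where n = n and x = x] s_pos
    by (simp add: case_prod_unfold flip: sum_divide_distrib)
  ultimately have partition: "partition_of_unity {0..1} {(k, j). j \<le> k \<and> k \<le> n}
      (\<lambda>(k, j) x. (real k + 1) / s n * Bernstein k j x)"
    using s_pos by (auto simp: partition_of_unity_def case_prod_unfold Bernstein_nonneg)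
  show ?thesis
    unfolding Bernstein_div_integral sum_Bernstein_N2 sum_monomials
    using s_pos optimal functional partition by simp
qed

end
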